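(* Let $G=G_+G_-$ be a group with unique factorisation and $\mathcal{P}(G)$ the corresponding bicrossproduct Hopf algebra in $\mathrm{SupLat}$. Drinfeld co-twists on $\mathcal{P}(G)$ are in bijection with maps $\Theta=(\Theta_1,\Theta_2):G_-\times G_-\to G_+\times G_+$ such that the map $F_\Theta:G_-\times G_-\to G_-\times G_-$, $F_\Theta(g,h)=\big({}^{\Theta_1(g,h)}g,\ {}^{\Theta_2(g,h)}h\big)$, is invertible, and $\Theta$ satisfies $\Theta_2(e_-,a)=e_+=\Theta_1(a,e_-)$ for all $a\in G_-$ and the following conditions, which hold in $G_+$ for all $a,b,c\in G_-$: $$\Theta_1\left({}^{\Theta_1(ab,c)}a,\ {}^{\Theta_1(ab,c)^{a}}b\right)\cdot\Theta_1(ab,c)=\Theta_1(a,bc),$$ $$\Theta_2\left({}^{\Theta_1(ab,c)}a,\ {}^{\Theta_1(ab,c)^{a}}b\right)\cdot\Theta_1(ab,c)^{a}=\Theta_1\left({}^{\Theta_2(a,bc)}b,\ {}^{\Theta_2(a,bc)^{b}}c\right)\cdot\Theta_2(a,bc),$$ $$\Theta_2(ab,c)=\Theta_2\left({}^{\Theta_2(a,bc)}b,\ {}^{\Theta_2(a,bc)^{b}}c\right)\cdot\Theta_2(a,bc)^{b}.$$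
   Context: $\mathrm{SupLat}$ is the category of complete lattices and join-preserving maps, symmetric monoidal with tensor product universal for maps preserving joins in each variable; its unit object is the two-element lattice $\mathcal{P}(1)=\{\emptyset,1\}$. $\mathcal{P}(S)$ is the power set of $S$ (free on $S$; singletons are identified with elements), and $\mathcal{P}(S)\otimes\mathcal{P}(T)=\mathcal{P}(S\times T)$. A group with unique factorisation $G=G_+G_-$ is a group $G$ with subgroups $G_+,G_-$ such that every element of $G$ is uniquely a product $a_+a_-$ with $a_\pm\in G_\pm$ (hence also uniquely a product of an element of $G_-$ and an element of $G_+$, in that order). For $u\in G_+$ and $x\in G_-$ define ${}^{u}x\in G_-$ and $u^{x}\in G_+$ by $ux=({}^{u}x)(u^{x})$. The identities of $G_\pm$ are denoted $e_\pm$. The Hopf algebra $\mathcal{P}(G)$ has, on basis elements: product $(g_+g_-).(h_+h_-)=g_+g_-h_-$ if $h_+=g_+^{\,g_-}$ and $\emptyset$ otherwise; unit $1=\bigvee_{g_+\in G_+}g_+$; coproduct $\Delta(a_+a_-)=\bigvee_{g\in G_+}a_+g^{-1}({}^{g}a_-)\otimes ga_-$; counit $\epsilon(a_+a_-)=1$ if $a_+=e_+$ and $\emptyset$ otherwise. A Drinfeld co-twist on a Hopf algebra $\mathcal{H}$ in $\mathrm{SupLat}$ is a morphism $\mathcal{F}:\mathcal{H}\otimes\mathcal{H}\to\mathcal{P}(1)$ for which there is a morphism $\mathcal{F}^{-1}:\mathcal{H}\otimes\mathcal{H}\to\mathcal{P}(1)$ such that for all $a,b,c\in\mathcal{H}$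 (Sweedler notation $\Delta(a)=a_{(1)}\otimes a_{(2)}$, joins suppressed): $\mathcal{F}^{-1}(a_{(1)},b_{(1)})\mathcal{F}(a_{(2)},b_{(2)})=\epsilon(a)\epsilon(b)=\mathcal{F}(a_{(1)},b_{(1)})\mathcal{F}^{-1}(a_{(2)},b_{(2)})$; $\mathcal{F}(a_{(1)}b_{(1)},c)\,\mathcal{F}(a_{(2)},b_{(2)})=\mathcal{F}(a,b_{(1)}c_{(1)})\,\mathcal{F}(b_{(2)},c_{(2)})$; and $\mathcal{F}(a,1)=\epsilon(a)=\mathcal{F}(1,a)$. *)

theory Defs
  imports "HOL-Algebra.Coset" "HOL-Library.FuncSet"
begin

section \<open>Join-preserving maps on power sets\<close>

text \<open>
  All complete lattices occurring below are free ones, i.e. power sets, and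
  \<open>P(S) \<otimes> P(T)\<close> is \<open>P(S \<times> T)\<close>, with \<open>a \<otimes> b\<close> being \<open>a \<times> b\<close>. The unit object
  \<open>P(1)\<close> is the two-element lattice \<^typ>\<open>bool\<close>; its multiplication
  \<open>P(1) \<otimes> P(1) \<cong> P(1)\<close> is conjunction.
\<close>

definition suplat_hom :: "'b set \<Rightarrow> ('b set \<Rightarrow> 'c::complete_lattice) \<Rightarrow> bool" where
  "suplat_hom S f \<longleftrightarrow> f \<in> extensional (Pow S) \<and>
     (\<forall>\<X>. \<X> \<subseteq> Pow S \<longrightarrow> f (\<Union>\<X>) = (SUP X\<in>\<X>. f X))"

text \<open>
  Structure maps of a Hopf algebra in SupLat whose underlying lattice is
  \<open>P(hbasis)\<close>. The antipode is left out because co-twists do not refer to it.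
  The unit morphism \<open>P(1) \<rightarrow> H\<close> is given by the image of \<open>1\<close>.
\<close>

record 'a suplat_hopf =
  hbasis :: "'a set"
  hmult :: "('a \<times> 'a) set \<Rightarrow> 'a set"
  hone :: "'a set"
  hcomult :: "'a set \<Rightarrow> ('a \<times> 'a) set"
  hcounit :: "'a set \<Rightarrow> bool"

text \<open>
  An expression \<open>E(a\<^sub>(\<^sub>1\<^sub>),a\<^sub>(\<^sub>2\<^sub>))\<close> in Sweedler notation stands for the join of all
  \<open>E({a1},{a2})\<close> with \<open>(a1,a2) \<in> \<Delta>(a)\<close>; in \<^typ>\<open>bool\<close> this join is an existential
  quantifier. The following is \<open>F'(a\<^sub>(\<^sub>1\<^sub>),b\<^sub>(\<^sub>1\<^sub>)) F(a\<^sub>(\<^sub>2\<^sub>),b\<^sub>(\<^sub>2\<^sub>))\<close>.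
\<close>

definition convolution ::
  "'a suplat_hopf \<Rightarrow> (('a \<times> 'a) set \<Rightarrow> bool) \<Rightarrow> (('a \<times> 'a) set \<Rightarrow> bool)
    \<Rightarrow> 'a set \<Rightarrow> 'a set \<Rightarrow> bool" where
  "convolution H F' F a b \<longleftrightarrow>
     (\<exists>(a1, a2)\<in>hcomult H a. \<exists>(b1, b2)\<in>hcomult H b. F' {(a1, b1)} \<and> F {(a2, b2)})"

definition drinfeld_cotwist :: "'a suplat_hopf \<Rightarrow> (('a \<times> 'a) set \<Rightarrow> bool) \<Rightarrow> bool" where
  "drinfeld_cotwist H F \<longleftrightarrow>
     suplat_hom (hbasis H \<times> hbasis H) F \<and>
     (\<exists>F'. suplat_hom (hbasis H \<times> hbasis H) F' \<and>
        (\<forall>a \<in> Pow (hbasis H). \<forall>b \<in> Pow (hbasis H).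
           convolution H F' F a b = (hcounit H a \<and> hcounit H b) \<and>
           convolution H F F' a b = (hcounit H a \<and> hcounit H b))) \<and>
     (\<forall>a \<in> Pow (hbasis H). \<forall>b \<in> Pow (hbasis H). \<forall>c \<in> Pow (hbasis H).
        (\<exists>(a1, a2)\<in>hcomult H a. \<exists>(b1, b2)\<in>hcomult H b.
           F (hmult H {(a1, b1)} \<times> c) \<and> F {(a2, b2)}) =
        (\<exists>(b1, b2)\<in>hcomult H b. \<exists>(c1, c2)\<in>hcomult H c.
           F (a \<times> hmult H {(b1, c1)}) \<and> F {(b2, c2)})) \<and>
     (\<forall>a \<in> Pow (hbasis H).
        F (a \<times> hone H) = hcounit H a \<and> F (hone H \<times> a) = hcounit H a)"

section \<open>Groups with unique factorisation\<close>

definition unique_factorisation :: "('a, 'm) monoid_scheme \<Rightarrow> 'a set \<Rightarrow> 'a set \<Rightarrow> bool" where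
  "unique_factorisation G Gp Gm \<longleftrightarrow>
     group G \<and> subgroup Gp G \<and> subgroup Gm G \<and>
     (\<forall>x \<in> carrier G. \<exists>!p. p \<in> Gp \<times> Gm \<and> x = fst p \<otimes>\<^bsub>G\<^esub> snd p)"

definition plus_part :: "('a, 'm) monoid_scheme \<Rightarrow> 'a set \<Rightarrow> 'a set \<Rightarrow> 'a \<Rightarrow> 'a" where
  "plus_part G Gp Gm x = (THE u. u \<in> Gp \<and> (\<exists>y\<in>Gm. x = u \<otimes>\<^bsub>G\<^esub> y))"

definition minus_part :: "('a, 'm) monoid_scheme \<Rightarrow> 'a set \<Rightarrow> 'a set \<Rightarrow> 'a \<Rightarrow> 'a" where
  "minus_part G Gp Gm x = (THE y. y \<in> Gm \<and> (\<exists>u\<in>Gp. x = u \<otimes>\<^bsub>G\<^esub> y))"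

text \<open>
  The two actions \<open>\<^sup>ux\<close> (\<open>lact\<close>) and \<open>u\<^sup>x\<close> (\<open>ract\<close>), determined by the opposite
  factorisation \<open>u x = (\<^sup>ux) (u\<^sup>x)\<close>.
\<close>

definition lact :: "('a, 'm) monoid_scheme \<Rightarrow> 'a set \<Rightarrow> 'a set \<Rightarrow> 'a \<Rightarrow> 'a \<Rightarrow> 'a" where
  "lact G Gp Gm u x = (THE y. y \<in> Gm \<and> (\<exists>w\<in>Gp. u \<otimes>\<^bsub>G\<^esub> x = y \<otimes>\<^bsub>G\<^esub> w))"

definition ract :: "('a, 'm) monoid_scheme \<Rightarrow> 'a set \<Rightarrow> 'a set \<Rightarrow> 'a \<Rightarrow> 'a \<Rightarrow> 'a" where
  "ract G Gp Gm u x = (THE w. w \<in> Gp \<and> (\<exists>y\<in>Gm. u \<otimes>\<^bsub>G\<^esub> x = y \<otimes>\<^bsub>G\<^esub> w))"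

section \<open>The bicrossproduct Hopf algebra\<close>

definition bicrossproduct ::
  "('a, 'm) monoid_scheme \<Rightarrow> 'a set \<Rightarrow> 'a set \<Rightarrow> 'a suplat_hopf" where
  "bicrossproduct G Gp Gm =
     \<lparr> hbasis = carrier G,
       hmult = (\<lambda>X. \<Union>(g, h)\<in>X.
         if plus_part G Gp Gm h = ract G Gp Gm (plus_part G Gp Gm g) (minus_part G Gp Gm g)
         then {plus_part G Gp Gm g \<otimes>\<^bsub>G\<^esub> minus_part G Gp Gm g \<otimes>\<^bsub>G\<^esub> minus_part G Gp Gm h}
         else {}),
       hone = Gp,
       hcomult = (\<lambda>X. \<Union>a\<in>X. \<Union>g\<in>Gp.
         {(plus_part G Gp Gm a \<otimes>\<^bsub>G\<^esub> inv\<^bsub>G\<^esub> g \<otimes>\<^bsub>G\<^esub> lact G Gp Gm g (minus_part G Gp Gm a),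
           g \<otimes>\<^bsub>G\<^esub> minus_part G Gp Gm a)}),
       hcounit = (\<lambda>X. \<exists>a\<in>X. plus_part G Gp Gm a = \<one>\<^bsub>G\<^esub>) \<rparr>"

section \<open>The parametrising maps\<close>

definition F_theta ::
  "('a, 'm) monoid_scheme \<Rightarrow> 'a set \<Rightarrow> 'a set \<Rightarrow> ('a \<times> 'a \<Rightarrow> 'a \<times> 'a) \<Rightarrow> 'a \<times> 'a \<Rightarrow> 'a \<times> 'a" where
  "F_theta G Gp Gm \<Theta> = (\<lambda>(g, h).
     (lact G Gp Gm (fst (\<Theta> (g, h))) g, lact G Gp Gm (snd (\<Theta> (g, h))) h))"

definition cotwist_maps ::
  "('a, 'm) monoid_scheme \<Rightarrow> 'a set \<Rightarrow> 'a set \<Rightarrow> ('a \<times> 'a \<Rightarrow> 'a \<times> 'a) set" where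
  "cotwist_maps G Gp Gm =
     {\<Theta> \<in> Gm \<times> Gm \<rightarrow>\<^sub>E Gp \<times> Gp.
        bij_betw (F_theta G Gp Gm \<Theta>) (Gm \<times> Gm) (Gm \<times> Gm) \<and>
        (let L = lact G Gp Gm; R = ract G Gp Gm;
             \<Theta>1 = (\<lambda>x y. fst (\<Theta> (x, y))); \<Theta>2 = (\<lambda>x y. snd (\<Theta> (x, y)))
         in (\<forall>a\<in>Gm. \<Theta>2 \<one>\<^bsub>G\<^esub> a = \<one>\<^bsub>G\<^esub> \<and> \<Theta>1 a \<one>\<^bsub>G\<^esub> = \<one>\<^bsub>G\<^esub>) \<and>
            (\<forall>a\<in>Gm. \<forall>b\<in>Gm. \<forall>c\<in>Gm.
               \<Theta>1 (L (\<Theta>1 (a \<otimes>\<^bsub>G\<^esub> b) c) a) (L (R (\<Theta>1 (a \<otimes>\<^bsub>G\<^esub> b) c) a) b) \<otimes>\<^bsub>G\<^esub> \<Theta>1 (a \<otimes>\<^bsub>G\<^esub> b) c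
                 = \<Theta>1 a (b \<otimes>\<^bsub>G\<^esub> c) \<and>
               \<Theta>2 (L (\<Theta>1 (a \<otimes>\<^bsub>G\<^esub> b) c) a) (L (R (\<Theta>1 (a \<otimes>\<^bsub>G\<^esub> b) c) a) b)
                   \<otimes>\<^bsub>G\<^esub> R (\<Theta>1 (a \<otimes>\<^bsub>G\<^esub> b) c) a
                 = \<Theta>1 (L (\<Theta>2 a (b \<otimes>\<^bsub>G\<^esub> c)) b) (L (R (\<Theta>2 a (b \<otimes>\<^bsub>G\<^esub> c)) b) c)
                   \<otimes>\<^bsub>G\<^esub> \<Theta>2 a (b \<otimes>\<^bsub>G\<^esub> c) \<and>
               \<Theta>2 (a \<otimes>\<^bsub>G\<^esub> b) c
                 = \<Theta>2 (L (\<Theta>2 a (b \<otimes>\<^bsub>G\<^esub> c)) b) (L (R (\<Theta>2 a (b \<otimes>\<^bsub>G\<^esub> c)) b) c)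
                   \<otimes>\<^bsub>G\<^esub> R (\<Theta>2 a (b \<otimes>\<^bsub>G\<^esub> c)) b))}"

text \<open>
  The co-twist attached to \<open>\<Theta>\<close>. Its convolution inverse is \<open>1\<close> at
  \<open>(a\<^sub>+ a\<^sub>-, b\<^sub>+ b\<^sub>-)\<close> iff \<open>(a\<^sub>+, b\<^sub>+) = \<Theta>(a\<^sub>-, b\<^sub>-)\<close>. It is the inverse that is
  supported on the graph of \<open>\<Theta>\<close>: inverting the co-twist equation reverses the
  order of its convolution products, and this is the order in which the three
  equations for \<open>\<Theta>\<close> compose the factors.
\<close>

definition cotwist_of_map ::
  "('a, 'm) monoid_scheme \<Rightarrow> 'a set \<Rightarrow> 'a set \<Rightarrow> ('a \<times> 'a \<Rightarrow> 'a \<times> 'a)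
    \<Rightarrow> ('a \<times> 'a) set \<Rightarrow> bool" where
  "cotwist_of_map G Gp Gm \<Theta> = (\<lambda>X\<in>Pow (carrier G \<times> carrier G). \<exists>g\<in>Gm. \<exists>h\<in>Gm.
     (inv\<^bsub>G\<^esub> fst (\<Theta> (g, h)) \<otimes>\<^bsub>G\<^esub> lact G Gp Gm (fst (\<Theta> (g, h))) g,
      inv\<^bsub>G\<^esub> snd (\<Theta> (g, h)) \<otimes>\<^bsub>G\<^esub> lact G Gp Gm (snd (\<Theta> (g, h))) h) \<in> X)"

end

theory Submission imports Defs begin

text \<open>
  A basis element \<open>a\<^sub>+ a\<^sub>-\<close> is best read as an arrow \<open>a\<^sub>- \<rightarrow> \<^sup>a\<^sup>+a\<^sub>-\<close> of the action groupoid
  of \<open>G\<^sub>+\<close> on \<open>G\<^sub>-\<close>. The coproduct then lists all ways of writing an arrow as a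
  composite, the counit singles out the identity arrows, and the product multiplies
  the sources of two arrows whenever their labels in \<open>G\<^sub>+\<close> are compatible. A functional on
  \<open>P(G) \<otimes> P(G)\<close> is a set of arrows of the groupoid of \<open>G\<^sub>+ \<times> G\<^sub>+\<close> acting on
  \<open>G\<^sub>- \<times> G\<^sub>-\<close>, and convolution of functionals is elementwise composition of such sets.

  A set of arrows of a groupoid is invertible under composition exactly when it is a
  bisection: every object is the source of exactly one of its arrows and the target of
  exactly one (\<open>mutually_inverse_imp_graph\<close>, \<open>graph_imp_mutually_inverse\<close>). In an action
  groupoid, a set with one arrow at each source is the graph of a map \<open>\<Theta>\<close>, and
  the condition on targets is the bijectivity of \<open>F\<^sub>\<Theta>\<close>.

  The co-twist of \<open>\<Theta>\<close> consists of the inverses of the arrows in the graph of \<open>\<Theta>\<close>, so all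
  of the Hopf algebra structure is transported along the inversion of arrows, which is an
  involution of the basis (\<open>rev_arrow\<close>). In these coordinates both sides of the co-twist
  equation, evaluated at \<open>u\<close> over \<open>a\<close>, \<open>v\<close> over \<open>b\<close> and \<open>w\<close> over \<open>c\<close>, say that \<open>(u,v,w)\<close> equals
  an explicit triple in \<open>G\<^sub>+\<close> computed from \<open>\<Theta>\<close> and \<open>a,b,c\<close>: each intermediate arrow has a
  known source, and \<open>\<Theta>\<close> determines it (\<open>cocycle_left_rev_arrow\<close>,
  \<open>cocycle_right_rev_arrow\<close>). The two sides agree for all \<open>u,v,w\<close> precisely when the two
  triples coincide, and comparing their entries gives the three equations for \<open>\<Theta>\<close>. The
  normalisation conditions follow in the same way.
\<close>

section \<open>Invertible relations on an action groupoid\<close>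

text \<open>
  The arrows of the action groupoid are the pairs \<open>(u, x)\<close>, from \<open>x\<close> to \<open>act u x\<close>; a set of
  arrows is represented by a relation between group elements and points.
\<close>

locale action_groupoid = group A for A (structure) +
  fixes X :: "'x set" and act :: "'a \<Rightarrow> 'x \<Rightarrow> 'x"
  assumes act_closed: "u \<in> carrier A \<Longrightarrow> x \<in> X \<Longrightarrow> act u x \<in> X"
    and act_one: "x \<in> X \<Longrightarrow> act \<one> x = x"
    and act_mult: "u \<in> carrier A \<Longrightarrow> v \<in> carrier A \<Longrightarrow> x \<in> X \<Longrightarrow> act (u \<otimes> v) x = act u (act v x)"
begin

text \<open>
  \<open>K'\<close> is traversed before \<open>K\<close>, which is the order of the tensor factors in
  \<open>convolution H F' F\<close> once arrows are reversed.
\<close>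

definition arrow_comp :: "('a \<Rightarrow> 'x \<Rightarrow> bool) \<Rightarrow> ('a \<Rightarrow> 'x \<Rightarrow> bool) \<Rightarrow> 'a \<Rightarrow> 'x \<Rightarrow> bool" where
  "arrow_comp K' K u x \<longleftrightarrow>
     (\<exists>p\<in>carrier A. \<exists>q\<in>carrier A. q \<otimes> p = u \<and> K' p x \<and> K q (act p x))"

definition mutually_inverse :: "('a \<Rightarrow> 'x \<Rightarrow> bool) \<Rightarrow> ('a \<Rightarrow> 'x \<Rightarrow> bool) \<Rightarrow> bool" where
  "mutually_inverse K' K \<longleftrightarrow>
     (\<forall>u\<in>carrier A. \<forall>x\<in>X. arrow_comp K' K u x = (u = \<one>) \<and> arrow_comp K K' u x = (u = \<one>))"

lemma act_inv_act: "u \<in> carrier A \<Longrightarrow> x \<in> X \<Longrightarrow> act (inv u) (act u x) = x"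
  by (metis act_mult act_one inv_closed l_inv)

text \<open>
  Any composite of an arrow of \<open>K\<close> and one of \<open>K'\<close>, in either order, is an identity, and at
  every object composites of both kinds exist. Hence all arrows of \<open>K\<close> out of \<open>x\<close> are
  inverse to one and the same arrow of \<open>K'\<close>, and likewise all arrows of \<open>K\<close> into \<open>y\<close>.
\<close>

lemma mutually_inverse_imp_graph:
  assumes inv: "mutually_inverse K' K"
  shows "\<exists>\<Theta>\<in>X \<rightarrow> carrier A. (\<forall>u\<in>carrier A. \<forall>x\<in>X. K u x \<longleftrightarrow> u = \<Theta> x) \<and>
           bij_betw (\<lambda>x. act (\<Theta> x) x) X X"
proof -
  have comp1: "q \<otimes> p = \<one>"
    if "K' p x" "K q (act p x)" "p \<in> carrier A" "q \<in> carrier A" "x \<in> X" for p q x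
    using inv that unfolding mutually_inverse_def arrow_comp_def by blast
  have comp2: "q \<otimes> p = \<one>"
    if "K p x" "K' q (act p x)" "p \<in> carrier A" "q \<in> carrier A" "x \<in> X" for p q x
    using inv that unfolding mutually_inverse_def arrow_comp_def by blast
  have ex1: "\<exists>p\<in>carrier A. K' p x \<and> K (inv p) (act p x)" if "x \<in> X" for x
  proof -
    have "arrow_comp K' K \<one> x" using inv that by (simp add: mutually_inverse_def)
    then show ?thesis unfolding arrow_comp_def by (metis inv_equality)
  qed
  have ex2: "\<exists>p\<in>carrier A. K p x \<and> K' (inv p) (act p x)" if "x \<in> X" for x
  proof -
    have "arrow_comp K K' \<one> x" using inv that by (simp add: mutually_inverse_def)
    then show ?thesis unfolding arrow_comp_def by (metis inv_equality)
  qed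
  have "\<exists>p\<in>carrier A. \<forall>u\<in>carrier A. K u x \<longleftrightarrow> u = p" if x: "x \<in> X" for x
  proof -
    obtain p where p: "p \<in> carrier A" "K p x" "K' (inv p) (act p x)" using ex2 x by blast
    have "u = p" if u: "u \<in> carrier A" "K u x" for u
    proof -
      have "u \<otimes> inv p = \<one>"
        using comp1[of "inv p" "act p x" u] p u x by (simp add: act_closed act_inv_act)
      then show ?thesis using p(1) u(1) inv_equality by fastforce
    qed
    then show ?thesis using p by blast
  qed
  then obtain \<Theta> where \<Theta>: "\<And>x. x \<in> X \<Longrightarrow> \<Theta> x \<in> carrier A"
    "\<And>x u. x \<in> X \<Longrightarrow> u \<in> carrier A \<Longrightarrow> K u x \<longleftrightarrow> u = \<Theta> x"
    by metis
  have src: "\<exists>r\<in>carrier A. \<forall>x\<in>X. act (\<Theta> x) x = y \<longleftrightarrow> x = act r y" if y: "y \<in> X" for y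
  proof -
    obtain r where r: "r \<in> carrier A" "K' r y" "K (inv r) (act r y)" using ex1 y by blast
    have "act (\<Theta> x) x = y \<longleftrightarrow> x = act r y" if x: "x \<in> X" for x
    proof
      assume eq: "act (\<Theta> x) x = y"
      have "r \<otimes> \<Theta> x = \<one>" using comp2[of "\<Theta> x" x r] r x eq \<Theta> by simp
      then show "x = act r y" using eq act_mult[of r "\<Theta> x" x] r x \<Theta> by (simp add: act_one)
    next
      assume eq: "x = act r y"
      then have "\<Theta> x = inv r" using r \<Theta>(2)[of x "inv r"] x by simp
      then show "act (\<Theta> x) x = y" using eq r y by (simp add: act_inv_act)
    qed
    then show ?thesis using r(1) by blast
  qed
  have "bij_betw (\<lambda>x. act (\<Theta> x) x) X X"
    unfolding bij_betw_def
  proof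
    show "inj_on (\<lambda>x. act (\<Theta> x) x) X"
      by (rule inj_onI) (metis src act_closed \<Theta>(1))
    show "(\<lambda>x. act (\<Theta> x) x) ` X = X"
    proof
      show "(\<lambda>x. act (\<Theta> x) x) ` X \<subseteq> X" using \<Theta>(1) act_closed by blast
      show "X \<subseteq> (\<lambda>x. act (\<Theta> x) x) ` X"
      proof
        fix y assume "y \<in> X"
        then obtain r where "r \<in> carrier A" "\<forall>x\<in>X. act (\<Theta> x) x = y \<longleftrightarrow> x = act r y"
          using src by blast
        moreover from this have "act r y \<in> X" using act_closed \<open>y \<in> X\<close> by simp
        ultimately have "act r y \<in> X" "y = act (\<Theta> (act r y)) (act r y)" by metis+
        then show "y \<in> (\<lambda>x. act (\<Theta> x) x) ` X" by blast
      qed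
    qed
  qed
  then show ?thesis using \<Theta> by blast
qed

text \<open>
  The inverse consists of the inverse arrows; bijectivity of the target map makes it
  single-valued and everywhere defined.
\<close>

lemma graph_imp_mutually_inverse:
  assumes \<Theta>: "\<Theta> \<in> X \<rightarrow> carrier A" and bij: "bij_betw (\<lambda>x. act (\<Theta> x) x) X X"
    and K: "\<And>u x. u \<in> carrier A \<Longrightarrow> x \<in> X \<Longrightarrow> K u x \<longleftrightarrow> u = \<Theta> x"
  shows "\<exists>K'. mutually_inverse K' K"
proof -
  have mem: "\<Theta> x \<in> carrier A" if "x \<in> X" for x using \<Theta> that by blast
  define K' where "K' q y \<longleftrightarrow> (\<exists>x\<in>X. y = act (\<Theta> x) x \<and> q = inv (\<Theta> x))" for q y
  have K'_act: "K' q (act (\<Theta> x) x) \<longleftrightarrow> q = inv (\<Theta> x)" if "x \<in> X" for q x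
    using that inj_onD[OF bij_betw_imp_inj_on[OF bij]] unfolding K'_def by blast
  have "arrow_comp K K' u x = (u = \<one>)" if u: "u \<in> carrier A" and x: "x \<in> X" for u x
  proof -
    have "arrow_comp K K' u x \<longleftrightarrow> inv (\<Theta> x) \<otimes> \<Theta> x = u"
      unfolding arrow_comp_def using K[OF _ x] K'_act[OF x] mem[OF x] inv_closed[OF mem[OF x]]
      by (metis (no_types, lifting))
    then show ?thesis using mem[OF x] by auto
  qed
  moreover have "arrow_comp K' K u y = (u = \<one>)" if u: "u \<in> carrier A" and y: "y \<in> X" for u y
  proof -
    obtain x where x: "x \<in> X" "y = act (\<Theta> x) x" using y bij unfolding bij_betw_def by blast
    have "arrow_comp K' K u y \<longleftrightarrow> \<Theta> x \<otimes> inv (\<Theta> x) = u"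
      unfolding arrow_comp_def x(2)
      using K'_act[OF x(1)] K[OF _ x(1)] mem[OF x(1)] act_inv_act[OF mem[OF x(1)] x(1)]
        inv_closed[OF mem[OF x(1)]]
      by (metis (no_types, lifting))
    then show ?thesis using mem[OF x(1)] by auto
  qed
  ultimately show ?thesis unfolding mutually_inverse_def by blast
qed

lemma graph_invertible_iff:
  assumes \<Theta>: "\<Theta> \<in> X \<rightarrow> carrier A"
    and K: "\<And>u x. u \<in> carrier A \<Longrightarrow> x \<in> X \<Longrightarrow> K u x \<longleftrightarrow> u = \<Theta> x"
  shows "(\<exists>K'. mutually_inverse K' K) \<longleftrightarrow> bij_betw (\<lambda>x. act (\<Theta> x) x) X X"
proof
  assume "\<exists>K'. mutually_inverse K' K"
  then obtain \<Theta>' where \<Theta>': "\<Theta>' \<in> X \<rightarrow> carrier A"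
      "\<forall>u\<in>carrier A. \<forall>x\<in>X. K u x \<longleftrightarrow> u = \<Theta>' x" "bij_betw (\<lambda>x. act (\<Theta>' x) x) X X"
    using mutually_inverse_imp_graph by blast
  have "\<Theta>' x = \<Theta> x" if "x \<in> X" for x
    using \<Theta>'(1,2) K[of "\<Theta>' x" x] that by (auto simp: Pi_iff)
  then show "bij_betw (\<lambda>x. act (\<Theta> x) x) X X"
    using \<Theta>'(3) by (simp cong: bij_betw_cong)
next
  assume "bij_betw (\<lambda>x. act (\<Theta> x) x) X X"
  then show "\<exists>K'. mutually_inverse K' K"
    using graph_imp_mutually_inverse \<Theta> K by blast
qed

lemma mutually_inverse_cong:
  assumes "\<And>u x. u \<in> carrier A \<Longrightarrow> x \<in> X \<Longrightarrow> K1 u x = K2 u x"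
  shows "mutually_inverse K1 K = mutually_inverse K2 K"
  using assms act_closed unfolding mutually_inverse_def arrow_comp_def
  by (intro ball_cong refl arg_cong2[of _ _ _ _ "(\<and>)"] arg_cong2[of _ _ _ _ "(=)"] bex_cong) simp_all

end

section \<open>The two actions of a factorised group\<close>

locale factorised_group =
  fixes G :: "('a, 'm) monoid_scheme" (structure) and Gp Gm :: "'a set"
  assumes unique_factorisation: "unique_factorisation G Gp Gm"
begin

sublocale group G
  using unique_factorisation by (simp add: unique_factorisation_def)

lemma plus_subgroup: "subgroup Gp G" and minus_subgroup: "subgroup Gm G"
  using unique_factorisation by (simp_all add: unique_factorisation_def)

lemmas plus_simps [simp] = subgroup.m_closed[OF plus_subgroup]
  subgroup.m_inv_closed[OF plus_subgroup] subgroup.one_closed[OF plus_subgroup]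
  subgroup.mem_carrier[OF plus_subgroup]

lemmas minus_simps [simp] = subgroup.m_closed[OF minus_subgroup]
  subgroup.m_inv_closed[OF minus_subgroup] subgroup.one_closed[OF minus_subgroup]
  subgroup.mem_carrier[OF minus_subgroup]

abbreviation L :: "'a \<Rightarrow> 'a \<Rightarrow> 'a" where "L \<equiv> lact G Gp Gm"
abbreviation R :: "'a \<Rightarrow> 'a \<Rightarrow> 'a" where "R \<equiv> ract G Gp Gm"
abbreviation H :: "'a suplat_hopf" where "H \<equiv> bicrossproduct G Gp Gm"

lemma plus_minus_cancel:
  assumes "u \<in> Gp" "v \<in> Gp" "x \<in> Gm" "y \<in> Gm" "u \<otimes> x = v \<otimes> y"
  shows "u = v" "x = y"
proof -
  have "\<exists>!p. p \<in> Gp \<times> Gm \<and> u \<otimes> x = fst p \<otimes> snd p"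
    using unique_factorisation assms by (simp add: unique_factorisation_def)
  then have "(u, x) = (v, y)" using assms by (metis SigmaI fst_conv snd_conv)
  then show "u = v" "x = y" by auto
qed

text \<open>
  Inversion of \<open>G\<close> exchanges the two orders of the factors, so the factorisation
  \<open>G = G\<^sub>- G\<^sub>+\<close> inherits uniqueness and existence from \<open>G = G\<^sub>+ G\<^sub>-\<close>.
\<close>

lemma minus_plus_cancel:
  assumes "u \<in> Gp" "v \<in> Gp" "x \<in> Gm" "y \<in> Gm" "x \<otimes> u = y \<otimes> v"
  shows "u = v" "x = y"
proof -
  have "inv u \<otimes> inv x = inv v \<otimes> inv y"
    using assms by (metis inv_mult_group minus_simps(4) plus_simps(4))
  then have "inv u = inv v" "inv x = inv y"
    using plus_minus_cancel[of "inv u" "inv v" "inv x" "inv y"] assms by simp_all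
  then show "u = v" "x = y" using assms by (auto intro: inj_onD[OF inv_inj])
qed

lemma factorisation_exists:
  assumes "a \<in> carrier G" obtains u x where "u \<in> Gp" "x \<in> Gm" "a = u \<otimes> x"
  using assms unique_factorisation unfolding unique_factorisation_def by (metis SigmaE fst_conv snd_conv)

lemma opposite_factorisation_exists:
  assumes "a \<in> carrier G" obtains u x where "u \<in> Gp" "x \<in> Gm" "a = x \<otimes> u"
proof -
  obtain u x where ux: "u \<in> Gp" "x \<in> Gm" "inv a = u \<otimes> x"
    using factorisation_exists assms inv_closed by metis
  then have "a = inv x \<otimes> inv u"
    by (metis assms inv_inv inv_mult_group minus_simps(4) plus_simps(4))
  then show ?thesis using that[of "inv u" "inv x"] ux by simp
qed

lemma plus_part_eq [simp]:
  assumes "u \<in> Gp" "x \<in> Gm" shows "plus_part G Gp Gm (u \<otimes> x) = u"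
  unfolding plus_part_def
proof (rule the_equality)
  show "u \<in> Gp \<and> (\<exists>y\<in>Gm. u \<otimes> x = u \<otimes> y)" using assms by blast
  show "w = u" if "w \<in> Gp \<and> (\<exists>y\<in>Gm. u \<otimes> x = w \<otimes> y)" for w
    using that assms plus_minus_cancel(1) by metis
qed

lemma minus_part_eq [simp]:
  assumes "u \<in> Gp" "x \<in> Gm" shows "minus_part G Gp Gm (u \<otimes> x) = x"
  unfolding minus_part_def
proof (rule the_equality)
  show "x \<in> Gm \<and> (\<exists>v\<in>Gp. u \<otimes> x = v \<otimes> x)" using assms by blast
  show "y = x" if "y \<in> Gm \<and> (\<exists>v\<in>Gp. u \<otimes> x = v \<otimes> y)" for y
    using that assms plus_minus_cancel(2) by metis
qed

lemma L_eqI: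
  assumes "u \<otimes> x = y \<otimes> w" "y \<in> Gm" "w \<in> Gp" shows "L u x = y"
  unfolding lact_def
proof (rule the_equality)
  show "y \<in> Gm \<and> (\<exists>w\<in>Gp. u \<otimes> x = y \<otimes> w)" using assms by blast
  show "z = y" if "z \<in> Gm \<and> (\<exists>w\<in>Gp. u \<otimes> x = z \<otimes> w)" for z
    using that assms minus_plus_cancel(2) by metis
qed

lemma R_eqI:
  assumes "u \<otimes> x = y \<otimes> w" "y \<in> Gm" "w \<in> Gp" shows "R u x = w"
  unfolding ract_def
proof (rule the_equality)
  show "w \<in> Gp \<and> (\<exists>y\<in>Gm. u \<otimes> x = y \<otimes> w)" using assms by blast
  show "v = w" if "v \<in> Gp \<and> (\<exists>y\<in>Gm. u \<otimes> x = y \<otimes> v)" for v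
    using that assms minus_plus_cancel(1) by metis
qed

lemma
  assumes "u \<in> Gp" "x \<in> Gm"
  shows L_closed [simp]: "L u x \<in> Gm" and R_closed [simp]: "R u x \<in> Gp"
    and L_mult_R: "L u x \<otimes> R u x = u \<otimes> x"
proof -
  obtain w y where "w \<in> Gp" "y \<in> Gm" "u \<otimes> x = y \<otimes> w"
    using opposite_factorisation_exists[of "u \<otimes> x"] assms by auto
  then show "L u x \<in> Gm" "R u x \<in> Gp" "L u x \<otimes> R u x = u \<otimes> x"
    using L_eqI R_eqI by metis+
qed

lemma L_one [simp]: "x \<in> Gm \<Longrightarrow> L \<one> x = x"
  by (rule L_eqI[of _ _ _ \<one>]) simp_all

lemma L_at_one [simp]: "u \<in> Gp \<Longrightarrow> L u \<one> = \<one>"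
  by (rule L_eqI[of _ _ _ u]) simp_all

lemma L_comp:
  assumes "u \<in> Gp" "v \<in> Gp" "x \<in> Gm" shows "L (u \<otimes> v) x = L u (L v x)"
proof (rule L_eqI)
  have "u \<otimes> v \<otimes> x = u \<otimes> (L v x \<otimes> R v x)" using assms by (simp add: m_assoc L_mult_R)
  also have "\<dots> = (u \<otimes> L v x) \<otimes> R v x" using assms by (simp add: m_assoc)
  also have "\<dots> = L u (L v x) \<otimes> R u (L v x) \<otimes> R v x" using assms by (simp add: L_mult_R)
  finally show "u \<otimes> v \<otimes> x = L u (L v x) \<otimes> (R u (L v x) \<otimes> R v x)"
    using assms by (simp add: m_assoc)
qed (use assms in simp_all)

lemma L_mult:
  assumes "u \<in> Gp" "x \<in> Gm" "y \<in> Gm" shows "L u (x \<otimes> y) = L u x \<otimes> L (R u x) y"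
proof (rule L_eqI)
  have "u \<otimes> (x \<otimes> y) = (u \<otimes> x) \<otimes> y" using assms by (simp add: m_assoc)
  also have "\<dots> = L u x \<otimes> R u x \<otimes> y" using assms by (simp add: L_mult_R)
  also have "\<dots> = L u x \<otimes> (R u x \<otimes> y)" using assms by (simp add: m_assoc)
  also have "\<dots> = L u x \<otimes> (L (R u x) y \<otimes> R (R u x) y)" using assms by (simp add: L_mult_R)
  finally show "u \<otimes> (x \<otimes> y) = L u x \<otimes> L (R u x) y \<otimes> R (R u x) y"
    using assms by (simp add: m_assoc)
qed (use assms in simp_all)

lemma L_inv [simp]:
  assumes "u \<in> Gp" "x \<in> Gm" shows "L (inv u) (L u x) = x"
  using assms by (simp flip: L_comp)

lemma R_inv:
  assumes "u \<in> Gp" "x \<in> Gm" shows "R (inv u) (L u x) = inv (R u x)"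
proof (rule R_eqI)
  have "L u x = u \<otimes> x \<otimes> inv (R u x)"
    using assms by (simp add: m_assoc flip: L_mult_R)
  then show "inv u \<otimes> L u x = x \<otimes> inv (R u x)"
    using assms by (simp add: m_assoc flip: m_assoc[of "inv u" u])
qed (use assms in simp_all)

section \<open>The Hopf algebra in terms of reversed arrows\<close>

text \<open>
  The inverse of the arrow \<open>x \<rightarrow> \<^sup>ux\<close> labelled by \<open>u\<close>. The Hopf algebra structure is
  described in these coordinates because the support of a co-twist is a set of inverse
  arrows, with \<open>\<Theta>\<close> the label map of the arrows before inversion.
\<close>

definition rev_arrow :: "'a \<Rightarrow> 'a \<Rightarrow> 'a" where
  "rev_arrow u x = inv u \<otimes> L u x"

lemma rev_arrow_closed [simp]: "u \<in> Gp \<Longrightarrow> x \<in> Gm \<Longrightarrow> rev_arrow u x \<in> carrier G"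
  by (simp add: rev_arrow_def)

lemma rev_arrow_inject [simp]:
  assumes "u \<in> Gp" "x \<in> Gm" "v \<in> Gp" "y \<in> Gm"
  shows "rev_arrow u x = rev_arrow v y \<longleftrightarrow> u = v \<and> x = y"
proof
  assume "rev_arrow u x = rev_arrow v y"
  then have "inv u = inv v" "L u x = L v y"
    using plus_minus_cancel[of "inv u" "inv v" "L u x" "L v y"] assms
    by (simp_all add: rev_arrow_def)
  then show "u = v \<and> x = y" using assms by (metis inv_inv plus_simps(4) L_inv)
qed simp

lemma rev_arrow_exists:
  assumes "a \<in> carrier G" obtains u x where "u \<in> Gp" "x \<in> Gm" "a = rev_arrow u x"
proof -
  obtain v y where "v \<in> Gp" "y \<in> Gm" "a = v \<otimes> y" using factorisation_exists assms by blast
  then show ?thesis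
    using that[of "inv v" "L v y"] by (simp add: rev_arrow_def)
qed

lemma plus_part_rev_arrow [simp]:
  "u \<in> Gp \<Longrightarrow> x \<in> Gm \<Longrightarrow> plus_part G Gp Gm (rev_arrow u x) = inv u"
  by (simp add: rev_arrow_def)

lemma minus_part_rev_arrow [simp]:
  "u \<in> Gp \<Longrightarrow> x \<in> Gm \<Longrightarrow> minus_part G Gp Gm (rev_arrow u x) = L u x"
  by (simp add: rev_arrow_def)

lemma hbasis_eq [simp]: "hbasis H = carrier G"
  by (simp add: bicrossproduct_def)

lemma hcomult_Union: "hcomult H A = (\<Union>a\<in>A. hcomult H {a})"
  by (simp add: bicrossproduct_def)

lemma hcounit_rev_arrow:
  "u \<in> Gp \<Longrightarrow> x \<in> Gm \<Longrightarrow> hcounit H {rev_arrow u x} \<longleftrightarrow> u = \<one>"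
  by (simp add: bicrossproduct_def inv_eq_1_iff)

lemma hcounit_ex: "hcounit H A \<longleftrightarrow> (\<exists>a\<in>A. hcounit H {a})"
  by (simp add: bicrossproduct_def)

lemma hone_eq: "hone H = (\<lambda>u. rev_arrow u \<one>) ` Gp"
proof -
  have "(\<lambda>u. inv u) ` Gp = Gp"
  proof
    show "Gp \<subseteq> (\<lambda>u. inv u) ` Gp" by (metis image_eqI inv_inv plus_simps(2,4) subsetI)
  qed auto
  then show ?thesis by (simp add: bicrossproduct_def rev_arrow_def)
qed

text \<open>
  The element \<open>g\<close> that indexes the coproduct is \<open>inv q\<close>, and \<open>p = g \<otimes> u\<close> is the label of
  the other factor. Inversion reverses composition, so the first tensor factor becomes the
  arrow that is traversed first.
\<close>

lemma hcomult_rev_arrow: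
  assumes u: "u \<in> Gp" and x: "x \<in> Gm"
  shows "hcomult H {rev_arrow u x} =
    {(rev_arrow p x, rev_arrow q (L p x)) | p q. p \<in> Gp \<and> q \<in> Gp \<and> q \<otimes> p = u}"
proof -
  have split: "(inv u \<otimes> inv g \<otimes> L g (L u x), g \<otimes> L u x) =
      (rev_arrow (g \<otimes> u) x, rev_arrow (inv g) (L (g \<otimes> u) x))" if "g \<in> Gp" for g
    using that u x by (simp add: rev_arrow_def inv_mult_group L_comp)
  have "hcomult H {rev_arrow u x} =
      (\<lambda>g. (rev_arrow (g \<otimes> u) x, rev_arrow (inv g) (L (g \<otimes> u) x))) ` Gp"
    using u x split by (auto simp: bicrossproduct_def)
  also have "\<dots> = {(rev_arrow p x, rev_arrow q (L p x)) | p q. p \<in> Gp \<and> q \<in> Gp \<and> q \<otimes> p = u}"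
    (is "?f ` Gp = ?S")
  proof
    show "?f ` Gp \<subseteq> ?S"
    proof
      fix z assume "z \<in> ?f ` Gp"
      then obtain g where g: "g \<in> Gp" "z = ?f g" by blast
      have "inv g \<otimes> (g \<otimes> u) = u" using g u by (simp flip: m_assoc)
      moreover have "g \<otimes> u \<in> Gp" "inv g \<in> Gp" using g u by simp_all
      ultimately show "z \<in> ?S" using g(2) by blast
    qed
    show "?S \<subseteq> ?f ` Gp"
    proof
      fix z assume "z \<in> ?S"
      then obtain p q where pq: "p \<in> Gp" "q \<in> Gp" "q \<otimes> p = u"
        "z = (rev_arrow p x, rev_arrow q (L p x))" by blast
      have "inv q \<otimes> u = p" unfolding pq(3)[symmetric] using pq(1,2) by (simp flip: m_assoc)
      then show "z \<in> ?f ` Gp" using pq by (intro image_eqI[of _ _ "inv q"]) auto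
    qed
  qed
  finally show ?thesis .
qed

text \<open>
  Inversion turns the compatibility condition for two arrows into the same condition for
  their inverses, by \<open>R_inv\<close>, and the product of the targets is the target of the product, by
  \<open>L_mult\<close>.
\<close>

lemma hmult_rev_arrow:
  assumes "p \<in> Gp" "x \<in> Gm" "q \<in> Gp" "y \<in> Gm"
  shows "hmult H {(rev_arrow p x, rev_arrow q y)} =
    (if q = R p x then {rev_arrow p (x \<otimes> y)} else {})"
proof -
  have "inv q = inv (R p x) \<longleftrightarrow> q = R p x"
    using assms by (metis inv_inv R_closed plus_simps(4))
  then show ?thesis
    using assms by (auto simp: bicrossproduct_def R_inv rev_arrow_def L_mult m_assoc)
qed

section \<open>Functionals as relations\<close>

text \<open>
  Every set is the union of its singletons, so a functional is the same as a subset of the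
  basis.
\<close>

lemma suplat_hom_bool_iff:
  "suplat_hom S (F :: 'b set \<Rightarrow> bool) \<longleftrightarrow>
     F \<in> extensional (Pow S) \<and> (\<forall>X\<subseteq>S. F X \<longleftrightarrow> (\<exists>s\<in>X. F {s}))"
proof
  assume F: "suplat_hom S F"
  have "F X \<longleftrightarrow> (\<exists>s\<in>X. F {s})" if "X \<subseteq> S" for X
  proof -
    have "F (\<Union>((\<lambda>s. {s}) ` X)) = (SUP Y\<in>(\<lambda>s. {s}) ` X. F Y)"
      using F that unfolding suplat_hom_def by (elim conjE allE[where x = "(\<lambda>s. {s}) ` X"]) auto
    then show ?thesis by simp
  qed
  then show "F \<in> extensional (Pow S) \<and> (\<forall>X\<subseteq>S. F X \<longleftrightarrow> (\<exists>s\<in>X. F {s}))"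
    using F by (simp add: suplat_hom_def)
next
  assume F: "F \<in> extensional (Pow S) \<and> (\<forall>X\<subseteq>S. F X \<longleftrightarrow> (\<exists>s\<in>X. F {s}))"
  have "F (\<Union>\<X>) = (SUP X\<in>\<X>. F X)" if \<X>: "\<X> \<subseteq> Pow S" for \<X>
  proof -
    have "\<Union>\<X> \<subseteq> S" "\<forall>X\<in>\<X>. X \<subseteq> S" using \<X> by auto
    then have "F (\<Union>\<X>) \<longleftrightarrow> (\<exists>s\<in>\<Union>\<X>. F {s})" "\<forall>X\<in>\<X>. F X \<longleftrightarrow> (\<exists>s\<in>X. F {s})"
      using F by blast+
    then show ?thesis by auto
  qed
  then show "suplat_hom S F" using F by (simp add: suplat_hom_def)
qed

definition arrow_rel :: "(('a \<times> 'a) set \<Rightarrow> bool) \<Rightarrow> 'a \<times> 'a \<Rightarrow> 'a \<times> 'a \<Rightarrow> bool" where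
  "arrow_rel F = (\<lambda>(u, v) (x, y). F {(rev_arrow u x, rev_arrow v y)})"

abbreviation functional :: "(('a \<times> 'a) set \<Rightarrow> bool) \<Rightarrow> bool" where
  "functional \<equiv> suplat_hom (carrier G \<times> carrier G)"

lemma functional_eqI:
  assumes F: "functional F" and F': "functional F'"
    and eq: "\<And>u v x y. u \<in> Gp \<Longrightarrow> v \<in> Gp \<Longrightarrow> x \<in> Gm \<Longrightarrow> y \<in> Gm \<Longrightarrow>
      arrow_rel F (u, v) (x, y) = arrow_rel F' (u, v) (x, y)"
  shows "F = F'"
proof (rule extensionalityI)
  show "F \<in> extensional (Pow (carrier G \<times> carrier G))"
    "F' \<in> extensional (Pow (carrier G \<times> carrier G))"
    using F F' by (simp_all add: suplat_hom_bool_iff)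
  have single: "F {s} = F' {s}" if s_in: "s \<in> carrier G \<times> carrier G" for s
  proof -
    obtain a b where s: "s = (a, b)" "a \<in> carrier G" "b \<in> carrier G" using s_in by blast
    obtain u x where ux: "u \<in> Gp" "x \<in> Gm" "a = rev_arrow u x" using s rev_arrow_exists by blast
    obtain v y where vy: "v \<in> Gp" "y \<in> Gm" "b = rev_arrow v y" using s rev_arrow_exists by blast
    show ?thesis using eq[of u v x y] s ux vy by (simp add: arrow_rel_def)
  qed
  fix X assume "X \<in> Pow (carrier G \<times> carrier G)"
  then have X: "X \<subseteq> carrier G \<times> carrier G" by simp
  have "F X \<longleftrightarrow> (\<exists>s\<in>X. F {s})" using F X by (simp add: suplat_hom_bool_iff)
  also have "\<dots> \<longleftrightarrow> (\<exists>s\<in>X. F' {s})" using single X by blast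
  also have "\<dots> \<longleftrightarrow> F' X" using F' X by (simp add: suplat_hom_bool_iff)
  finally show "F X = F' X" .
qed

lemma functional_of_rel:
  obtains F where "functional F"
    "\<And>u v x y. u \<in> Gp \<Longrightarrow> v \<in> Gp \<Longrightarrow> x \<in> Gm \<Longrightarrow> y \<in> Gm \<Longrightarrow>
      arrow_rel F (u, v) (x, y) = K (u, v) (x, y)"
proof
  let ?F = "\<lambda>X\<in>Pow (carrier G \<times> carrier G).
    \<exists>u\<in>Gp. \<exists>v\<in>Gp. \<exists>x\<in>Gm. \<exists>y\<in>Gm. (rev_arrow u x, rev_arrow v y) \<in> X \<and> K (u, v) (x, y)"
  show "functional ?F"
    unfolding suplat_hom_bool_iff by (intro conjI restrict_extensional allI impI) (simp, blast)
  show "arrow_rel ?F (u, v) (x, y) = K (u, v) (x, y)"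
    if "u \<in> Gp" "v \<in> Gp" "x \<in> Gm" "y \<in> Gm" for u v x y
    using that by (auto simp: arrow_rel_def)
qed

abbreviation Gp2 where "Gp2 \<equiv> G\<lparr>carrier := Gp\<rparr> \<times>\<times> G\<lparr>carrier := Gp\<rparr>"

definition L2 :: "'a \<times> 'a \<Rightarrow> 'a \<times> 'a \<Rightarrow> 'a \<times> 'a" where
  "L2 = (\<lambda>(u, v) (x, y). (L u x, L v y))"

lemma Gp2_simps [simp]:
  "carrier Gp2 = Gp \<times> Gp" "\<one>\<^bsub>Gp2\<^esub> = (\<one>, \<one>)"
  "(u, v) \<otimes>\<^bsub>Gp2\<^esub> (u', v') = (u \<otimes> u', v \<otimes> v')"
  by (simp_all add: DirProd_def)

lemma action_L2: "action_groupoid Gp2 (Gm \<times> Gm) L2"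
proof -
  interpret P: group "G\<lparr>carrier := Gp\<rparr>"
    using plus_subgroup subgroup.subgroup_is_group is_group by blast
  interpret group Gp2 by (intro DirProd_group P.is_group)
  show ?thesis
    by unfold_locales (auto simp: L2_def L_comp)
qed

sublocale sq: action_groupoid Gp2 "Gm \<times> Gm" L2
  by (rule action_L2)

lemma convolution_rev_arrow:
  assumes "u \<in> Gp" "v \<in> Gp" "x \<in> Gm" "y \<in> Gm"
  shows "convolution H F' F {rev_arrow u x} {rev_arrow v y} \<longleftrightarrow>
    sq.arrow_comp (arrow_rel F') (arrow_rel F) (u, v) (x, y)"
  unfolding convolution_def sq.arrow_comp_def
  using assms by (simp add: hcomult_rev_arrow arrow_rel_def L2_def) blast

lemma convolution_ex:
  "convolution H F' F A B \<longleftrightarrow> (\<exists>a\<in>A. \<exists>b\<in>B. convolution H F' F {a} {b})"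
  unfolding convolution_def hcomult_Union[of A] hcomult_Union[of B] by blast

lemma all_rev_arrow:
  "(\<forall>a\<in>carrier G. P a) \<longleftrightarrow> (\<forall>u\<in>Gp. \<forall>x\<in>Gm. P (rev_arrow u x))"
  by (metis rev_arrow_exists rev_arrow_closed)

lemma convolution_inverse_iff:
  "(\<forall>a \<in> Pow (carrier G). \<forall>b \<in> Pow (carrier G).
      convolution H F' F a b = (hcounit H a \<and> hcounit H b) \<and>
      convolution H F F' a b = (hcounit H a \<and> hcounit H b)) \<longleftrightarrow>
    sq.mutually_inverse (arrow_rel F') (arrow_rel F)"
  (is "?all \<longleftrightarrow> _")
proof -
  have "?all \<longleftrightarrow> (\<forall>a\<in>carrier G. \<forall>b\<in>carrier G.
      convolution H F' F {a} {b} = (hcounit H {a} \<and> hcounit H {b}) \<and>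
      convolution H F F' {a} {b} = (hcounit H {a} \<and> hcounit H {b}))" (is "_ \<longleftrightarrow> ?single")
  proof
    assume ?all
    then show ?single by simp
  next
    assume s: ?single
    show ?all
    proof (intro ballI)
      fix a b assume "a \<in> Pow (carrier G)" "b \<in> Pow (carrier G)"
      then have *: "\<And>z w. z \<in> a \<Longrightarrow> w \<in> b \<Longrightarrow> z \<in> carrier G \<and> w \<in> carrier G" by blast
      show "convolution H F' F a b = (hcounit H a \<and> hcounit H b) \<and>
          convolution H F F' a b = (hcounit H a \<and> hcounit H b)"
        unfolding convolution_ex[of _ _ a b] hcounit_ex[of a] hcounit_ex[of b] using s * by blast
    qed
  qed
  also have "\<dots> \<longleftrightarrow> sq.mutually_inverse (arrow_rel F') (arrow_rel F)"
    unfolding all_rev_arrow sq.mutually_inverse_def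
    by (auto simp: convolution_rev_arrow hcounit_rev_arrow)
  finally show ?thesis .
qed

section \<open>Co-twists supported on a graph\<close>

lemma functional_cotwist_of_map: "functional (cotwist_of_map G Gp Gm \<Theta>)"
  unfolding suplat_hom_bool_iff cotwist_of_map_def
  by (intro conjI restrict_extensional allI impI) (simp, blast)

lemma cotwist_of_map_empty: "\<not> cotwist_of_map G Gp Gm \<Theta> {}"
  by (simp add: cotwist_of_map_def)

lemma components_closed:
  assumes "\<Theta> \<in> Gm \<times> Gm \<rightarrow> Gp \<times> Gp" "x \<in> Gm" "y \<in> Gm"
  shows "fst (\<Theta> (x, y)) \<in> Gp" "snd (\<Theta> (x, y)) \<in> Gp"
  using assms by (auto simp: Pi_iff mem_Times_iff)

lemma cotwist_of_map_rev_arrow: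
  assumes \<Theta>: "\<Theta> \<in> Gm \<times> Gm \<rightarrow> Gp \<times> Gp" and "u \<in> Gp" "v \<in> Gp" "x \<in> Gm" "y \<in> Gm"
  shows "cotwist_of_map G Gp Gm \<Theta> {(rev_arrow u x, rev_arrow v y)} \<longleftrightarrow>
    u = fst (\<Theta> (x, y)) \<and> v = snd (\<Theta> (x, y))"
  using assms components_closed[OF \<Theta>] unfolding cotwist_of_map_def
  by (auto simp flip: rev_arrow_def)

lemma arrow_rel_cotwist_of_map:
  assumes "\<Theta> \<in> Gm \<times> Gm \<rightarrow> Gp \<times> Gp" "u \<in> Gp \<times> Gp" "x \<in> Gm \<times> Gm"
  shows "arrow_rel (cotwist_of_map G Gp Gm \<Theta>) u x \<longleftrightarrow> u = \<Theta> x"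
  using assms by (auto simp: arrow_rel_def cotwist_of_map_rev_arrow prod_eq_iff)

lemma graph_functional_eq:
  assumes \<Theta>: "\<Theta> \<in> Gm \<times> Gm \<rightarrow> Gp \<times> Gp" and F: "functional F"
    and graph: "\<forall>u\<in>Gp \<times> Gp. \<forall>x\<in>Gm \<times> Gm. arrow_rel F u x \<longleftrightarrow> u = \<Theta> x"
  shows "F = cotwist_of_map G Gp Gm \<Theta>"
  by (rule functional_eqI[OF F functional_cotwist_of_map])
    (use graph arrow_rel_cotwist_of_map[OF \<Theta>] in simp)

lemma cotwist_of_map_inj:
  "inj_on (cotwist_of_map G Gp Gm) (Gm \<times> Gm \<rightarrow>\<^sub>E Gp \<times> Gp)"
proof (rule inj_onI)
  fix \<Theta> \<Theta>'
  assume \<Theta>: "\<Theta> \<in> Gm \<times> Gm \<rightarrow>\<^sub>E Gp \<times> Gp" and \<Theta>': "\<Theta>' \<in> Gm \<times> Gm \<rightarrow>\<^sub>E Gp \<times> Gp"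
    and eq: "cotwist_of_map G Gp Gm \<Theta> = cotwist_of_map G Gp Gm \<Theta>'"
  show "\<Theta> = \<Theta>'"
  proof (rule PiE_ext[OF \<Theta> \<Theta>'])
    fix x assume x: "x \<in> Gm \<times> Gm"
    then have "\<Theta> x \<in> Gp \<times> Gp" using \<Theta> by blast
    then show "\<Theta> x = \<Theta>' x"
      using arrow_rel_cotwist_of_map[of \<Theta> "\<Theta> x" x] arrow_rel_cotwist_of_map[of \<Theta>' "\<Theta> x" x]
        x eq \<Theta> \<Theta>' by (auto simp: PiE_def)
  qed
qed

lemma functional_invertible_iff:
  "(\<exists>F'. functional F' \<and>
      (\<forall>a \<in> Pow (carrier G). \<forall>b \<in> Pow (carrier G).
         convolution H F' F a b = (hcounit H a \<and> hcounit H b) \<and>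
         convolution H F F' a b = (hcounit H a \<and> hcounit H b))) \<longleftrightarrow>
   (\<exists>K'. sq.mutually_inverse K' (arrow_rel F))"
  unfolding convolution_inverse_iff
proof
  assume "\<exists>K'. sq.mutually_inverse K' (arrow_rel F)"
  then obtain K' where K': "sq.mutually_inverse K' (arrow_rel F)" by blast
  obtain F' where F': "functional F'"
    "\<And>u v x y. u \<in> Gp \<Longrightarrow> v \<in> Gp \<Longrightarrow> x \<in> Gm \<Longrightarrow> y \<in> Gm \<Longrightarrow>
      arrow_rel F' (u, v) (x, y) = K' (u, v) (x, y)"
    using functional_of_rel[of K'] by blast
  have "sq.mutually_inverse (arrow_rel F') (arrow_rel F)"
    using K' F'(2) sq.mutually_inverse_cong[of "arrow_rel F'" K' "arrow_rel F"] by auto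
  then show "\<exists>F'. functional F' \<and> sq.mutually_inverse (arrow_rel F') (arrow_rel F)"
    using F'(1) by blast
qed blast

lemma F_theta_eq: "F_theta G Gp Gm \<Theta> = (\<lambda>x. L2 (\<Theta> x) x)"
  by (auto simp: F_theta_def L2_def split: prod.splits)

section \<open>The co-twist equation on reversed arrows\<close>

lemma hcomult_closed: "A \<subseteq> carrier G \<Longrightarrow> hcomult H A \<subseteq> carrier G \<times> carrier G"
  unfolding hcomult_Union[of A]
proof (rule UN_least)
  fix a assume "A \<subseteq> carrier G" "a \<in> A"
  then obtain u x where "u \<in> Gp" "x \<in> Gm" "a = rev_arrow u x" using rev_arrow_exists by blast
  then show "hcomult H {a} \<subseteq> carrier G \<times> carrier G" by (auto simp: hcomult_rev_arrow)
qed

lemma hmult_closed: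
  assumes "a \<in> carrier G" "b \<in> carrier G" shows "hmult H {(a, b)} \<subseteq> carrier G"
proof -
  obtain u x where ux: "u \<in> Gp" "x \<in> Gm" "a = rev_arrow u x" using assms rev_arrow_exists by blast
  obtain v y where "v \<in> Gp" "y \<in> Gm" "b = rev_arrow v y" using assms rev_arrow_exists by blast
  then show ?thesis using ux by (simp add: hmult_rev_arrow)
qed

definition cocycle_left :: "(('a \<times> 'a) set \<Rightarrow> bool) \<Rightarrow> 'a set \<Rightarrow> 'a set \<Rightarrow> 'a set \<Rightarrow> bool" where
  "cocycle_left F a b c \<longleftrightarrow>
     (\<exists>(a1, a2)\<in>hcomult H a. \<exists>(b1, b2)\<in>hcomult H b.
        F (hmult H {(a1, b1)} \<times> c) \<and> F {(a2, b2)})"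

definition cocycle_right :: "(('a \<times> 'a) set \<Rightarrow> bool) \<Rightarrow> 'a set \<Rightarrow> 'a set \<Rightarrow> 'a set \<Rightarrow> bool" where
  "cocycle_right F a b c \<longleftrightarrow>
     (\<exists>(b1, b2)\<in>hcomult H b. \<exists>(c1, c2)\<in>hcomult H c.
        F (a \<times> hmult H {(b1, c1)}) \<and> F {(b2, c2)})"

lemma functional_times:
  assumes "functional F" "A \<subseteq> carrier G" "B \<subseteq> carrier G"
  shows "F (A \<times> B) \<longleftrightarrow> (\<exists>a\<in>A. \<exists>b\<in>B. F {(a, b)})"
proof -
  have "A \<times> B \<subseteq> carrier G \<times> carrier G" using assms by blast
  then have "F (A \<times> B) \<longleftrightarrow> (\<exists>s\<in>A \<times> B. F {s})" using assms(1) by (simp add: suplat_hom_bool_iff)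
  then show ?thesis by auto
qed

lemma
  assumes F: "functional F" and A: "A \<subseteq> carrier G" and B: "B \<subseteq> carrier G"
  shows functional_times_left: "F (A \<times> B) \<longleftrightarrow> (\<exists>a\<in>A. F ({a} \<times> B))"
    and functional_times_right: "F (A \<times> B) \<longleftrightarrow> (\<exists>b\<in>B. F (A \<times> {b}))"
proof -
  have "F ({a} \<times> B) \<longleftrightarrow> (\<exists>b\<in>B. F {(a, b)})" if "a \<in> A" for a
    using functional_times[OF F, of "{a}" B] that A B by auto
  then show "F (A \<times> B) \<longleftrightarrow> (\<exists>a\<in>A. F ({a} \<times> B))"
    using functional_times[OF F A B] by blast
  have "F (A \<times> {b}) \<longleftrightarrow> (\<exists>a\<in>A. F {(a, b)})" if "b \<in> B" for b
    using functional_times[OF F, of A "{b}"] that A B by auto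
  then show "F (A \<times> B) \<longleftrightarrow> (\<exists>b\<in>B. F (A \<times> {b}))"
    using functional_times[OF F A B] by blast
qed

lemma cocycle_left_ex:
  assumes F: "functional F" and sub: "A \<subseteq> carrier G" "B \<subseteq> carrier G" "C \<subseteq> carrier G"
  shows "cocycle_left F A B C \<longleftrightarrow> (\<exists>a\<in>A. \<exists>b\<in>B. \<exists>c\<in>C. cocycle_left F {a} {b} {c})"
proof -
  have "F (hmult H {(a1, b1)} \<times> C) \<longleftrightarrow> (\<exists>c\<in>C. F (hmult H {(a1, b1)} \<times> {c}))"
    if "(a1, a2) \<in> hcomult H A" "(b1, b2) \<in> hcomult H B" for a1 a2 b1 b2
  proof -
    have *: "hmult H {(a1, b1)} \<subseteq> carrier G"
      using that hcomult_closed sub by (intro hmult_closed) blast+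
    show ?thesis by (rule functional_times_right[OF F * sub(3)])
  qed
  then have "cocycle_left F A B C \<longleftrightarrow> (\<exists>c\<in>C. cocycle_left F A B {c})"
    unfolding cocycle_left_def by fast
  also have "\<dots> \<longleftrightarrow> (\<exists>a\<in>A. \<exists>b\<in>B. \<exists>c\<in>C. cocycle_left F {a} {b} {c})"
    unfolding cocycle_left_def hcomult_Union[of A] hcomult_Union[of B] by blast
  finally show ?thesis .
qed

lemma cocycle_right_ex:
  assumes F: "functional F" and sub: "A \<subseteq> carrier G" "B \<subseteq> carrier G" "C \<subseteq> carrier G"
  shows "cocycle_right F A B C \<longleftrightarrow> (\<exists>a\<in>A. \<exists>b\<in>B. \<exists>c\<in>C. cocycle_right F {a} {b} {c})"
proof -
  have "F (A \<times> hmult H {(b1, c1)}) \<longleftrightarrow> (\<exists>a\<in>A. F ({a} \<times> hmult H {(b1, c1)}))"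
    if "(b1, b2) \<in> hcomult H B" "(c1, c2) \<in> hcomult H C" for b1 b2 c1 c2
  proof -
    have *: "hmult H {(b1, c1)} \<subseteq> carrier G"
      using that hcomult_closed sub by (intro hmult_closed) blast+
    show ?thesis by (rule functional_times_left[OF F sub(1) *])
  qed
  then have "cocycle_right F A B C \<longleftrightarrow> (\<exists>a\<in>A. cocycle_right F {a} B C)"
    unfolding cocycle_right_def by fast
  also have "\<dots> \<longleftrightarrow> (\<exists>a\<in>A. \<exists>b\<in>B. \<exists>c\<in>C. cocycle_right F {a} {b} {c})"
    unfolding cocycle_right_def hcomult_Union[of B] hcomult_Union[of C] by blast
  finally show ?thesis .
qed

lemma cocycle_sets_iff:
  assumes "functional F"
  shows "(\<forall>a \<in> Pow (carrier G). \<forall>b \<in> Pow (carrier G). \<forall>c \<in> Pow (carrier G).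
      cocycle_left F a b c = cocycle_right F a b c) \<longleftrightarrow>
    (\<forall>u\<in>Gp. \<forall>x\<in>Gm. \<forall>v\<in>Gp. \<forall>y\<in>Gm. \<forall>w\<in>Gp. \<forall>z\<in>Gm.
      cocycle_left F {rev_arrow u x} {rev_arrow v y} {rev_arrow w z} =
      cocycle_right F {rev_arrow u x} {rev_arrow v y} {rev_arrow w z})" (is "?all \<longleftrightarrow> _")
proof -
  have "?all \<longleftrightarrow> (\<forall>a\<in>carrier G. \<forall>b\<in>carrier G. \<forall>c\<in>carrier G.
      cocycle_left F {a} {b} {c} = cocycle_right F {a} {b} {c})" (is "_ \<longleftrightarrow> ?single")
  proof
    assume ?all
    then show ?single by simp
  next
    assume s: ?single
    show ?all
    proof (intro ballI)
      fix a b c assume "a \<in> Pow (carrier G)" "b \<in> Pow (carrier G)" "c \<in> Pow (carrier G)"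
      then have *: "a \<subseteq> carrier G" "b \<subseteq> carrier G" "c \<subseteq> carrier G" by simp_all
      show "cocycle_left F a b c = cocycle_right F a b c"
        unfolding cocycle_left_ex[OF assms *] cocycle_right_ex[OF assms *]
        using s * by (intro bex_cong refl) blast
    qed
  qed
  then show ?thesis unfolding all_rev_arrow .
qed

text \<open>
  The arrow \<open>p\<close> over \<open>x\<close> and the arrow \<open>r\<close> over \<open>y\<close> are traversed first. They are multiplied
  to \<open>p\<close> over \<open>x \<otimes> y\<close>, which forces \<open>r = R p x\<close>, and pairing the product with \<open>z\<close> forces
  \<open>p = \<Theta>1 (x \<otimes> y) z\<close>. The remaining arrows \<open>q\<close> and \<open>t\<close> start at the targets \<open>L p x\<close> and
  \<open>L r y\<close>, where \<open>\<Theta>\<close> determines them.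
\<close>

lemma cocycle_left_rev_arrow:
  fixes \<Theta>1 \<Theta>2 :: "'a \<Rightarrow> 'a \<Rightarrow> 'a"
  assumes \<Theta>: "\<Theta> \<in> Gm \<times> Gm \<rightarrow> Gp \<times> Gp"
    and mem: "u \<in> Gp" "x \<in> Gm" "v \<in> Gp" "y \<in> Gm" "w \<in> Gp" "z \<in> Gm"
  defines "\<Theta>1 \<equiv> \<lambda>x y. fst (\<Theta> (x, y))" and "\<Theta>2 \<equiv> \<lambda>x y. snd (\<Theta> (x, y))"
  shows "cocycle_left (cotwist_of_map G Gp Gm \<Theta>)
      {rev_arrow u x} {rev_arrow v y} {rev_arrow w z} \<longleftrightarrow>
    u = \<Theta>1 (L (\<Theta>1 (x \<otimes> y) z) x) (L (R (\<Theta>1 (x \<otimes> y) z) x) y) \<otimes> \<Theta>1 (x \<otimes> y) z \<and>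
    v = \<Theta>2 (L (\<Theta>1 (x \<otimes> y) z) x) (L (R (\<Theta>1 (x \<otimes> y) z) x) y) \<otimes> R (\<Theta>1 (x \<otimes> y) z) x \<and>
    w = \<Theta>2 (x \<otimes> y) z"
proof -
  let ?F = "cotwist_of_map G Gp Gm \<Theta>"
  have closed: "\<Theta>1 a b \<in> Gp" "\<Theta>2 a b \<in> Gp" if "a \<in> Gm" "b \<in> Gm" for a b
    using components_closed[OF \<Theta>] that by (simp_all add: \<Theta>1_def \<Theta>2_def)
  have val: "?F {(rev_arrow p a, rev_arrow q b)} \<longleftrightarrow> p = \<Theta>1 a b \<and> q = \<Theta>2 a b"
    if "p \<in> Gp" "q \<in> Gp" "a \<in> Gm" "b \<in> Gm" for p q a b
    using cotwist_of_map_rev_arrow[OF \<Theta> that] by (simp add: \<Theta>1_def \<Theta>2_def)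
  have "cocycle_left ?F {rev_arrow u x} {rev_arrow v y} {rev_arrow w z} \<longleftrightarrow>
    (\<exists>p\<in>Gp. \<exists>q\<in>Gp. \<exists>r\<in>Gp. \<exists>t\<in>Gp. q \<otimes> p = u \<and> t \<otimes> r = v \<and>
       ?F (hmult H {(rev_arrow p x, rev_arrow r y)} \<times> {rev_arrow w z}) \<and>
       ?F {(rev_arrow q (L p x), rev_arrow t (L r y))})"
    unfolding cocycle_left_def by (simp add: hcomult_rev_arrow mem) blast
  also have "\<dots> \<longleftrightarrow> (\<exists>p\<in>Gp. \<exists>q\<in>Gp. \<exists>r\<in>Gp. \<exists>t\<in>Gp. q \<otimes> p = u \<and> t \<otimes> r = v \<and>
       r = R p x \<and> p = \<Theta>1 (x \<otimes> y) z \<and> w = \<Theta>2 (x \<otimes> y) z \<and>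
       q = \<Theta>1 (L p x) (L r y) \<and> t = \<Theta>2 (L p x) (L r y))"
    by (intro bex_cong refl) (auto simp: hmult_rev_arrow val cotwist_of_map_empty mem)
  also have "\<dots> \<longleftrightarrow>
    u = \<Theta>1 (L (\<Theta>1 (x \<otimes> y) z) x) (L (R (\<Theta>1 (x \<otimes> y) z) x) y) \<otimes> \<Theta>1 (x \<otimes> y) z \<and>
    v = \<Theta>2 (L (\<Theta>1 (x \<otimes> y) z) x) (L (R (\<Theta>1 (x \<otimes> y) z) x) y) \<otimes> R (\<Theta>1 (x \<otimes> y) z) x \<and>
    w = \<Theta>2 (x \<otimes> y) z"
    using closed mem by auto
  finally show ?thesis .
qed

text \<open>
  As on the left-hand side, except that the arrows over \<open>y\<close> and \<open>z\<close> are split and multiplied,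
  so that it is \<open>\<Theta>2 x (y \<otimes> z)\<close> which labels the arrow traversed first over \<open>y\<close>.
\<close>

lemma cocycle_right_rev_arrow:
  fixes \<Theta>1 \<Theta>2 :: "'a \<Rightarrow> 'a \<Rightarrow> 'a"
  assumes \<Theta>: "\<Theta> \<in> Gm \<times> Gm \<rightarrow> Gp \<times> Gp"
    and mem: "u \<in> Gp" "x \<in> Gm" "v \<in> Gp" "y \<in> Gm" "w \<in> Gp" "z \<in> Gm"
  defines "\<Theta>1 \<equiv> \<lambda>x y. fst (\<Theta> (x, y))" and "\<Theta>2 \<equiv> \<lambda>x y. snd (\<Theta> (x, y))"
  shows "cocycle_right (cotwist_of_map G Gp Gm \<Theta>)
      {rev_arrow u x} {rev_arrow v y} {rev_arrow w z} \<longleftrightarrow>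
    u = \<Theta>1 x (y \<otimes> z) \<and>
    v = \<Theta>1 (L (\<Theta>2 x (y \<otimes> z)) y) (L (R (\<Theta>2 x (y \<otimes> z)) y) z) \<otimes> \<Theta>2 x (y \<otimes> z) \<and>
    w = \<Theta>2 (L (\<Theta>2 x (y \<otimes> z)) y) (L (R (\<Theta>2 x (y \<otimes> z)) y) z) \<otimes> R (\<Theta>2 x (y \<otimes> z)) y"
proof -
  let ?F = "cotwist_of_map G Gp Gm \<Theta>"
  have closed: "\<Theta>1 a b \<in> Gp" "\<Theta>2 a b \<in> Gp" if "a \<in> Gm" "b \<in> Gm" for a b
    using components_closed[OF \<Theta>] that by (simp_all add: \<Theta>1_def \<Theta>2_def)
  have val: "?F {(rev_arrow p a, rev_arrow q b)} \<longleftrightarrow> p = \<Theta>1 a b \<and> q = \<Theta>2 a b"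
    if "p \<in> Gp" "q \<in> Gp" "a \<in> Gm" "b \<in> Gm" for p q a b
    using cotwist_of_map_rev_arrow[OF \<Theta> that] by (simp add: \<Theta>1_def \<Theta>2_def)
  have "cocycle_right ?F {rev_arrow u x} {rev_arrow v y} {rev_arrow w z} \<longleftrightarrow>
    (\<exists>p\<in>Gp. \<exists>q\<in>Gp. \<exists>r\<in>Gp. \<exists>t\<in>Gp. q \<otimes> p = v \<and> t \<otimes> r = w \<and>
       ?F ({rev_arrow u x} \<times> hmult H {(rev_arrow p y, rev_arrow r z)}) \<and>
       ?F {(rev_arrow q (L p y), rev_arrow t (L r z))})"
    unfolding cocycle_right_def by (simp add: hcomult_rev_arrow mem) blast
  also have "\<dots> \<longleftrightarrow> (\<exists>p\<in>Gp. \<exists>q\<in>Gp. \<exists>r\<in>Gp. \<exists>t\<in>Gp. q \<otimes> p = v \<and> t \<otimes> r = w \<and>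
       r = R p y \<and> u = \<Theta>1 x (y \<otimes> z) \<and> p = \<Theta>2 x (y \<otimes> z) \<and>
       q = \<Theta>1 (L p y) (L r z) \<and> t = \<Theta>2 (L p y) (L r z))"
    by (intro bex_cong refl) (auto simp: hmult_rev_arrow val cotwist_of_map_empty mem)
  also have "\<dots> \<longleftrightarrow>
    u = \<Theta>1 x (y \<otimes> z) \<and>
    v = \<Theta>1 (L (\<Theta>2 x (y \<otimes> z)) y) (L (R (\<Theta>2 x (y \<otimes> z)) y) z) \<otimes> \<Theta>2 x (y \<otimes> z) \<and>
    w = \<Theta>2 (L (\<Theta>2 x (y \<otimes> z)) y) (L (R (\<Theta>2 x (y \<otimes> z)) y) z) \<otimes> R (\<Theta>2 x (y \<otimes> z)) y"
    using closed mem by auto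
  finally show ?thesis .
qed

lemma all_triple_eq_iff:
  assumes "\<alpha> \<in> S" "\<beta> \<in> S" "\<gamma> \<in> S" "\<alpha>' \<in> S" "\<beta>' \<in> S" "\<gamma>' \<in> S"
  shows "(\<forall>u\<in>S. \<forall>v\<in>S. \<forall>w\<in>S. (u = \<alpha> \<and> v = \<beta> \<and> w = \<gamma>) = (u = \<alpha>' \<and> v = \<beta>' \<and> w = \<gamma>')) \<longleftrightarrow>
    \<alpha> = \<alpha>' \<and> \<beta> = \<beta>' \<and> \<gamma> = \<gamma>'"
  using assms by auto

section \<open>The correspondence\<close>

text \<open>
  The unit is the join of the arrows at the fixed point \<open>\<one>\<close> of \<open>G\<^sub>-\<close>, with arbitrary label.
  Pairing with it therefore leaves one component of \<open>\<Theta>\<close> unconstrained, and the counit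
  demands that the other one be trivial.
\<close>

lemma normalised_iff:
  assumes \<Theta>: "\<Theta> \<in> Gm \<times> Gm \<rightarrow> Gp \<times> Gp"
  defines "F \<equiv> cotwist_of_map G Gp Gm \<Theta>"
  shows "(\<forall>a \<in> Pow (carrier G). F (a \<times> hone H) = hcounit H a \<and> F (hone H \<times> a) = hcounit H a) \<longleftrightarrow>
    (\<forall>x\<in>Gm. snd (\<Theta> (\<one>, x)) = \<one> \<and> fst (\<Theta> (x, \<one>)) = \<one>)" (is "?all \<longleftrightarrow> ?norm")
proof -
  have F: "functional F" unfolding F_def by (rule functional_cotwist_of_map)
  have one: "hone H \<subseteq> carrier G" by (auto simp: hone_eq)
  note closed = components_closed[OF \<Theta>]
  have val: "F {(rev_arrow p a, rev_arrow q b)} \<longleftrightarrow> p = fst (\<Theta> (a, b)) \<and> q = snd (\<Theta> (a, b))"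
    if "p \<in> Gp" "q \<in> Gp" "a \<in> Gm" "b \<in> Gm" for p q a b
    using cotwist_of_map_rev_arrow[OF \<Theta> that] by (simp add: F_def)
  have right: "F ({rev_arrow u x} \<times> hone H) \<longleftrightarrow> u = fst (\<Theta> (x, \<one>))"
    and left: "F (hone H \<times> {rev_arrow u x}) \<longleftrightarrow> u = snd (\<Theta> (\<one>, x))"
    if "u \<in> Gp" "x \<in> Gm" for u x
    using that one closed val by (auto simp: functional_times[OF F] hone_eq)
  have "?all \<longleftrightarrow> (\<forall>a\<in>carrier G. F ({a} \<times> hone H) = hcounit H {a} \<and> F (hone H \<times> {a}) = hcounit H {a})"
    (is "_ \<longleftrightarrow> ?single")
  proof
    assume ?all
    then show ?single by simp
  next
    assume s: ?single
    show ?all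
    proof
      fix a assume "a \<in> Pow (carrier G)"
      then have a: "a \<subseteq> carrier G" by simp
      have "F (a \<times> hone H) \<longleftrightarrow> (\<exists>b\<in>a. F ({b} \<times> hone H))"
        "F (hone H \<times> a) \<longleftrightarrow> (\<exists>b\<in>a. F (hone H \<times> {b}))"
        using functional_times_left[OF F a one] functional_times_right[OF F one a] .
      then show "F (a \<times> hone H) = hcounit H a \<and> F (hone H \<times> a) = hcounit H a"
        unfolding hcounit_ex[of a] using s a by blast
    qed
  qed
  also have "\<dots> \<longleftrightarrow> ?norm"
    unfolding all_rev_arrow using closed by (auto simp: right left hcounit_rev_arrow)
  finally show ?thesis .
qed

lemma drinfeld_cotwist_cotwist_of_map_iff:
  assumes \<Theta>: "\<Theta> \<in> Gm \<times> Gm \<rightarrow>\<^sub>E Gp \<times> Gp"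
  shows "drinfeld_cotwist H (cotwist_of_map G Gp Gm \<Theta>) \<longleftrightarrow> \<Theta> \<in> cotwist_maps G Gp Gm"
proof -
  let ?F = "cotwist_of_map G Gp Gm \<Theta>"
  define \<Theta>1 where "\<Theta>1 = (\<lambda>x y. fst (\<Theta> (x, y)))"
  define \<Theta>2 where "\<Theta>2 = (\<lambda>x y. snd (\<Theta> (x, y)))"
  have \<Theta>': "\<Theta> \<in> Gm \<times> Gm \<rightarrow> Gp \<times> Gp" using \<Theta> by (simp add: PiE_def)
  have closed [simp]: "\<Theta>1 a b \<in> Gp" "\<Theta>2 a b \<in> Gp" if "a \<in> Gm" "b \<in> Gm" for a b
    using components_closed[OF \<Theta>'] that by (simp_all add: \<Theta>1_def \<Theta>2_def)
  have inverse: "(\<exists>K'. sq.mutually_inverse K' (arrow_rel ?F)) \<longleftrightarrow>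
      bij_betw (F_theta G Gp Gm \<Theta>) (Gm \<times> Gm) (Gm \<times> Gm)"
    unfolding F_theta_eq
    by (rule sq.graph_invertible_iff) (use \<Theta>' arrow_rel_cotwist_of_map in simp_all)
  have cocycle: "(\<forall>a \<in> Pow (carrier G). \<forall>b \<in> Pow (carrier G). \<forall>c \<in> Pow (carrier G).
      cocycle_left ?F a b c = cocycle_right ?F a b c) \<longleftrightarrow>
    (\<forall>a\<in>Gm. \<forall>b\<in>Gm. \<forall>c\<in>Gm.
      \<Theta>1 (L (\<Theta>1 (a \<otimes> b) c) a) (L (R (\<Theta>1 (a \<otimes> b) c) a) b) \<otimes> \<Theta>1 (a \<otimes> b) c = \<Theta>1 a (b \<otimes> c) \<and>
      \<Theta>2 (L (\<Theta>1 (a \<otimes> b) c) a) (L (R (\<Theta>1 (a \<otimes> b) c) a) b) \<otimes> R (\<Theta>1 (a \<otimes> b) c) a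
        = \<Theta>1 (L (\<Theta>2 a (b \<otimes> c)) b) (L (R (\<Theta>2 a (b \<otimes> c)) b) c) \<otimes> \<Theta>2 a (b \<otimes> c) \<and>
      \<Theta>2 (a \<otimes> b) c
        = \<Theta>2 (L (\<Theta>2 a (b \<otimes> c)) b) (L (R (\<Theta>2 a (b \<otimes> c)) b) c) \<otimes> R (\<Theta>2 a (b \<otimes> c)) b)"
    (is "?cocycle \<longleftrightarrow> (\<forall>a\<in>Gm. \<forall>b\<in>Gm. \<forall>c\<in>Gm. ?eqs a b c)")
  proof -
    have "?cocycle \<longleftrightarrow> (\<forall>x\<in>Gm. \<forall>y\<in>Gm. \<forall>z\<in>Gm. \<forall>u\<in>Gp. \<forall>v\<in>Gp. \<forall>w\<in>Gp.
      cocycle_left ?F {rev_arrow u x} {rev_arrow v y} {rev_arrow w z} =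
      cocycle_right ?F {rev_arrow u x} {rev_arrow v y} {rev_arrow w z})"
      unfolding cocycle_sets_iff[OF functional_cotwist_of_map] by blast
    also have "\<dots> \<longleftrightarrow> (\<forall>a\<in>Gm. \<forall>b\<in>Gm. \<forall>c\<in>Gm. ?eqs a b c)"
    proof (intro ball_cong refl)
      fix x y z assume mem: "x \<in> Gm" "y \<in> Gm" "z \<in> Gm"
      show "(\<forall>u\<in>Gp. \<forall>v\<in>Gp. \<forall>w\<in>Gp.
          cocycle_left ?F {rev_arrow u x} {rev_arrow v y} {rev_arrow w z} =
          cocycle_right ?F {rev_arrow u x} {rev_arrow v y} {rev_arrow w z}) \<longleftrightarrow> ?eqs x y z"
        using mem unfolding \<Theta>1_def \<Theta>2_def
        by (simp add: cocycle_left_rev_arrow[OF \<Theta>'] cocycle_right_rev_arrow[OF \<Theta>']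
            all_triple_eq_iff closed[unfolded \<Theta>1_def \<Theta>2_def] cong: ball_cong)
    qed
    finally show ?thesis .
  qed
  show ?thesis
    unfolding drinfeld_cotwist_def hbasis_eq functional_invertible_iff inverse
      cocycle_left_def[symmetric] cocycle_right_def[symmetric] cocycle normalised_iff[OF \<Theta>']
    using \<Theta> functional_cotwist_of_map[of \<Theta>]
    by (auto simp: cotwist_maps_def Let_def \<Theta>1_def \<Theta>2_def)
qed

text \<open>
  Invertibility under convolution alone forces the support of a co-twist to be the graph of
  a map, up to inversion of arrows.
\<close>

lemma drinfeld_cotwist_imp_cotwist_of_map:
  assumes "drinfeld_cotwist H F"
  shows "\<exists>\<Theta>\<in>Gm \<times> Gm \<rightarrow>\<^sub>E Gp \<times> Gp. F = cotwist_of_map G Gp Gm \<Theta>"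
proof -
  have F: "functional F" and "\<exists>K'. sq.mutually_inverse K' (arrow_rel F)"
    using assms unfolding drinfeld_cotwist_def hbasis_eq functional_invertible_iff by blast+
  then obtain \<Theta> where \<Theta>: "\<Theta> \<in> Gm \<times> Gm \<rightarrow> Gp \<times> Gp"
    "\<forall>u\<in>Gp \<times> Gp. \<forall>x\<in>Gm \<times> Gm. arrow_rel F u x \<longleftrightarrow> u = \<Theta> x"
    using sq.mutually_inverse_imp_graph[of _ "arrow_rel F"] unfolding Gp2_simps(1) by blast
  let ?\<Theta> = "restrict \<Theta> (Gm \<times> Gm)"
  have "?\<Theta> \<in> Gm \<times> Gm \<rightarrow>\<^sub>E Gp \<times> Gp" using \<Theta>(1) by (simp add: restrict_PiE_iff Pi_iff)
  moreover have "F = cotwist_of_map G Gp Gm ?\<Theta>"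
    by (rule graph_functional_eq[OF _ F]) (use \<Theta> in auto)
  ultimately show ?thesis by blast
qed

end

theorem theorem4p2:
  fixes G :: "('a, 'm) monoid_scheme" and Gp Gm :: "'a set"
  assumes "unique_factorisation G Gp Gm"
  shows "bij_betw (cotwist_of_map G Gp Gm)
           (cotwist_maps G Gp Gm)
           {F. drinfeld_cotwist (bicrossproduct G Gp Gm) F}"
proof -
  interpret factorised_group G Gp Gm by (rule factorised_group.intro[OF assms])
  have sub: "cotwist_maps G Gp Gm \<subseteq> Gm \<times> Gm \<rightarrow>\<^sub>E Gp \<times> Gp"
    by (auto simp: cotwist_maps_def)
  show ?thesis
    unfolding bij_betw_def
  proof
    show "inj_on (cotwist_of_map G Gp Gm) (cotwist_maps G Gp Gm)"
      using cotwist_of_map_inj sub by (rule inj_on_subset)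
    show "cotwist_of_map G Gp Gm ` cotwist_maps G Gp Gm =
        {F. drinfeld_cotwist (bicrossproduct G Gp Gm) F}"
    proof
      show "cotwist_of_map G Gp Gm ` cotwist_maps G Gp Gm \<subseteq> {F. drinfeld_cotwist H F}"
        using drinfeld_cotwist_cotwist_of_map_iff sub by auto
      show "{F. drinfeld_cotwist H F} \<subseteq> cotwist_of_map G Gp Gm ` cotwist_maps G Gp Gm"
      proof
        fix F assume "F \<in> {F. drinfeld_cotwist H F}"
        then have F: "drinfeld_cotwist H F" by simp
        then obtain \<Theta> where "\<Theta> \<in> Gm \<times> Gm \<rightarrow>\<^sub>E Gp \<times> Gp" "F = cotwist_of_map G Gp Gm \<Theta>"
          using drinfeld_cotwist_imp_cotwist_of_map by blast
        then show "F \<in> cotwist_of_map G Gp Gm ` cotwist_maps G Gp Gm"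
          using drinfeld_cotwist_cotwist_of_map_iff F by auto
      qed
    qed
  qed
qed

end
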